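(* Let $\mathcal{X}\subseteq\mathbb{R}^n$ be a compact set, let $f:\mathcal{X}\to\mathbb{R}$ and $h_1,\dots,h_m:\mathbb{R}^n\to\mathbb{R}$ be continuous, and assume $h_j(x)\ge 0$ for all $x\in\mathcal{X}$, $j=1,\dots,m$. Assume that $\mathcal{X}\cap\mathcal{H}\neq\emptyset$ and that $\mathcal{X}\setminus\mathcal{H}$ is closed. Then: (i) For any $y\in\mathbb{R}^m$ such that $y_j\ge \frac{(P)^*-(D_0)^*}{\tilde h}$ for $j=1,\dots,m$, $(D_y)$ is a Lagrangian reformulation of $(P)$, i.e. $(D_y)^*=(P)^*$. (ii) For each $y\in\mathbb{R}^m$ such that $y_j> \frac{(P)^*-(D_0)^*}{\tilde h}$ for $j=1,\dots,m$, $(D_y)$ is equivalent to $(P)$; that is, the set of optimal solutions of $(D_y)$ coincides with the set of optimal solutions of $(P)$.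
   Context: $\mathcal{H}=\{x\in\mathbb{R}^n: h_j(x)=0,\ j=1,\dots,m\}$. $(P)$ is the problem $\min\{f(x): h_j(x)=0,\ j=1,\dots,m,\ x\in\mathcal{X}\}$. For $y\in\mathbb{R}^m$, $(D_y)$ is the problem $\min_{x\in\mathcal{X}}\big(f(x)+\sum_{j=1}^m y_jh_j(x)\big)$; in particular $(D_0)^*=\min_{x\in\mathcal{X}}f(x)$. $(\cdot)^*$ denotes the optimal value of the problem $(\cdot)$; the optimal value of an infeasible minimization problem is $+\infty$. Let $h(x)=\sum_{j=1}^m h_j(x)$ and $d(x,\mathcal{H})=\min\{\|x-z\|:z\in\mathcal{H}\}$. For $\epsilon>0$ let $h^\epsilon=\min\{h(x):x\in\mathcal{X},\ d(x,\mathcal{H})\ge\epsilon\}$ (equal to $+\infty$ if there is no such $x$), and $\tilde h=\lim_{\epsilon\downarrow 0}h^\epsilon\in[0,+\infty]$. If $\tilde h=+\infty$ (which happens when $\mathcal{X}\setminus\mathcal{H}=\emptyset$), a quotient of a real number by $\tilde h$ is read as $0$. *)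

theory Defs
  imports "HOL-Analysis.Analysis"
begin

text \<open>A minimization problem is given by its feasible set and its objective. Optimal values are
  extended reals, so that an infeasible problem has optimal value \<open>\<infinity>\<close>.\<close>

definition opt_value :: "'a set \<Rightarrow> ('a \<Rightarrow> real) \<Rightarrow> ereal" where
  "opt_value S g = (INF x\<in>S. ereal (g x))"

definition opt_solutions :: "'a set \<Rightarrow> ('a \<Rightarrow> real) \<Rightarrow> 'a set" where
  "opt_solutions S g = {x \<in> S. \<forall>z\<in>S. g x \<le> g z}"

definition zero_locus :: "('m \<Rightarrow> real ^ 'n \<Rightarrow> real) \<Rightarrow> (real ^ 'n) set" where
  "zero_locus h = {x. \<forall>j. h j x = 0}"

definition P_value ::
  "(real ^ 'n) set \<Rightarrow> (real ^ 'n \<Rightarrow> real) \<Rightarrow> ('m \<Rightarrow> real ^ 'n \<Rightarrow> real) \<Rightarrow> ereal" where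
  "P_value X f h = opt_value (X \<inter> zero_locus h) f"

definition P_solutions ::
  "(real ^ 'n) set \<Rightarrow> (real ^ 'n \<Rightarrow> real) \<Rightarrow> ('m \<Rightarrow> real ^ 'n \<Rightarrow> real) \<Rightarrow> (real ^ 'n) set" where
  "P_solutions X f h = opt_solutions (X \<inter> zero_locus h) f"

definition lagrangian ::
  "(real ^ 'n \<Rightarrow> real) \<Rightarrow> ('m::finite \<Rightarrow> real ^ 'n \<Rightarrow> real) \<Rightarrow> real ^ 'm \<Rightarrow> real ^ 'n \<Rightarrow> real" where
  "lagrangian f h y x = f x + (\<Sum>j\<in>UNIV. y $ j * h j x)"

definition D_value ::
  "(real ^ 'n) set \<Rightarrow> (real ^ 'n \<Rightarrow> real) \<Rightarrow> ('m::finite \<Rightarrow> real ^ 'n \<Rightarrow> real) \<Rightarrow> real ^ 'm \<Rightarrow> ereal" where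
  "D_value X f h y = opt_value X (lagrangian f h y)"

definition D_solutions ::
  "(real ^ 'n) set \<Rightarrow> (real ^ 'n \<Rightarrow> real) \<Rightarrow> ('m::finite \<Rightarrow> real ^ 'n \<Rightarrow> real) \<Rightarrow> real ^ 'm
    \<Rightarrow> (real ^ 'n) set" where
  "D_solutions X f h y = opt_solutions X (lagrangian f h y)"

text \<open>The value \<^term>\<open>infdist x (zero_locus h)\<close> is the Euclidean distance to the zero locus
  whenever the latter is nonempty (for the empty set, \<^const>\<open>infdist\<close> is 0); for continuous
  \<open>h\<close> the locus is closed and the distance is attained.\<close>

definition h_eps ::
  "(real ^ 'n) set \<Rightarrow> ('m::finite \<Rightarrow> real ^ 'n \<Rightarrow> real) \<Rightarrow> real \<Rightarrow> ereal" where
  "h_eps X h \<epsilon> = opt_value {x \<in> X. infdist x (zero_locus h) \<ge> \<epsilon>} (\<lambda>x. \<Sum>j\<in>UNIV. h j x)"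

definition h_tilde ::
  "(real ^ 'n) set \<Rightarrow> ('m::finite \<Rightarrow> real ^ 'n \<Rightarrow> real) \<Rightarrow> ereal" where
  "h_tilde X h = Lim (at_right 0) (h_eps X h)"

text \<open>Division on \<^typ>\<open>ereal\<close> satisfies \<open>a / \<infinity> = 0\<close> for real \<open>a\<close>.\<close>

definition multiplier_bound ::
  "(real ^ 'n) set \<Rightarrow> (real ^ 'n \<Rightarrow> real) \<Rightarrow> ('m::finite \<Rightarrow> real ^ 'n \<Rightarrow> real) \<Rightarrow> ereal" where
  "multiplier_bound X f h = (P_value X f h - D_value X f h 0) / h_tilde X h"

end

theory Submission
  imports Defs
begin

text \<open>Since \<open>X - zero_locus h\<close> is compact, it lies at positive distance from the zero locus, so
  \<open>h_eps X h\<close> is constant for small \<open>\<epsilon>\<close> and \<open>h_tilde X h\<close> is the minimum \<open>\<mu> > 0\<close> of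
  \<open>\<Sum>j. h j x\<close> over \<open>X - zero_locus h\<close>. Let \<open>p\<close> and \<open>d\<close> be the minima of \<open>f\<close> over
  \<open>X \<inter> zero_locus h\<close> and over \<open>X\<close>. If every multiplier is at least \<open>b = (p - d) / \<mu> \<ge> 0\<close>, then at an
  infeasible point \<open>x\<close> the Lagrangian is at least \<open>d + b * (\<Sum>j. h j x) \<ge> d + b * \<mu> = p\<close>, strictly
  if all multipliers exceed \<open>b\<close>; at feasible points it equals \<open>f\<close>.\<close>

lemma opt_value_eq:
  assumes "x \<in> opt_solutions S g"
  shows "opt_value S g = ereal (g x)"
  using assms unfolding opt_value_def opt_solutions_def
  by (intro antisym INF_lower INF_greatest) auto

lemma opt_solutions_nonempty:
  fixes g :: "'a::topological_space \<Rightarrow> real"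
  assumes "compact S" "S \<noteq> {}" "continuous_on S g"
  shows "opt_solutions S g \<noteq> {}"
  using continuous_attains_inf[OF assms] unfolding opt_solutions_def by auto

text \<open>Meant for \<open>F\<close> the feasible set of (P), \<open>S = X\<close> and
  \<open>g\<close> the Lagrangian. The point \<open>p\<close> keeps its value under
  \<open>g\<close>, and no point outside \<open>F\<close> gets below that value, so \<open>p\<close>
  minimizes \<open>g\<close> over \<open>S\<close> as well.\<close>

lemma opt_value_exact_extension:
  assumes "F \<subseteq> S" "\<And>x. x \<in> F \<Longrightarrow> g x = f x"
    and "p \<in> opt_solutions F f" "\<And>x. x \<in> S - F \<Longrightarrow> f p \<le> g x"
  shows "opt_value S g = opt_value F f"
proof -
  have "p \<in> opt_solutions S g"
    unfolding opt_solutions_def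
  proof (intro CollectI conjI ballI)
    show "p \<in> S" using assms(1,3) by (auto simp: opt_solutions_def)
    show "g p \<le> g z" if "z \<in> S" for z
      using assms that by (cases "z \<in> F") (auto simp: opt_solutions_def)
  qed
  moreover have "g p = f p"
    using assms(2,3) by (simp add: opt_solutions_def)
  ultimately show ?thesis
    using assms(3) by (simp add: opt_value_eq)
qed

text \<open>Strictness outside \<open>F\<close> is what excludes new minimizers: a minimizer of
  \<open>g\<close> over \<open>S\<close> has value at most \<open>g p = f p\<close>, hence lies in
  \<open>F\<close>, where \<open>g\<close> and \<open>f\<close> agree.\<close>

lemma opt_solutions_exact_extension:
  assumes "F \<subseteq> S" "\<And>x. x \<in> F \<Longrightarrow> g x = f x"
    and "p \<in> opt_solutions F f" "\<And>x. x \<in> S - F \<Longrightarrow> f p < g x"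
  shows "opt_solutions S g = opt_solutions F f"
proof (intro equalityI subsetI)
  have p: "p \<in> F" "\<And>z. z \<in> F \<Longrightarrow> f p \<le> f z"
    using assms(3) by (auto simp: opt_solutions_def)
  fix x
  show "x \<in> opt_solutions F f" if x: "x \<in> opt_solutions S g"
  proof -
    have "g x \<le> f p"
      using x p(1) assms(1,2) by (force simp: opt_solutions_def)
    then have "x \<in> F"
      using x assms(4)[of x] by (auto simp: opt_solutions_def)
    then show ?thesis
      using x assms(1,2) by (force simp: opt_solutions_def)
  qed
  show "x \<in> opt_solutions S g" if x: "x \<in> opt_solutions F f"
  proof -
    have "x \<in> F" "f x \<le> f p"
      using x p(1) by (auto simp: opt_solutions_def)
    moreover have "g x \<le> g z" if "z \<in> S" for z
    proof (cases "z \<in> F")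
      case True
      then show ?thesis using x assms(2) \<open>x \<in> F\<close> by (auto simp: opt_solutions_def)
    next
      case False
      then show ?thesis using assms(2)[OF \<open>x \<in> F\<close>] assms(4)[of z] that \<open>f x \<le> f p\<close> by auto
    qed
    ultimately show ?thesis using assms(1) by (auto simp: opt_solutions_def)
  qed
qed

lemma lagrangian_eq_on_zero_locus: "x \<in> zero_locus h \<Longrightarrow> lagrangian f h y x = f x"
  by (simp add: lagrangian_def zero_locus_def)

lemma lagrangian_zero [simp]: "lagrangian f h 0 = f"
  by (simp add: lagrangian_def fun_eq_iff)

lemma closed_zero_locus:
  assumes "\<And>j. continuous_on UNIV (h j)"
  shows "closed (zero_locus h)"
proof -
  have "zero_locus h = (\<Inter>j. {x. h j x = 0})"
    by (auto simp: zero_locus_def)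
  then show ?thesis
    using assms by (auto intro!: closed_INT closed_Collect_eq continuous_on_const)
qed

lemma h_tilde_eq_minimum:
  fixes h :: "'m::finite \<Rightarrow> real ^ 'n \<Rightarrow> real"
  assumes cont: "\<And>j. continuous_on UNIV (h j)"
    and comp: "compact (X - zero_locus h)" and ne: "zero_locus h \<noteq> {}"
    and x0: "x0 \<in> opt_solutions (X - zero_locus h) (\<lambda>x. \<Sum>j\<in>UNIV. h j x)"
  shows "h_tilde X h = ereal (\<Sum>j\<in>UNIV. h j x0)"
proof -
  let ?H = "zero_locus h"
  \<comment> \<open>Closedness gives the equivalence only for a nonempty locus, since
    \<open>infdist\<close> to the empty set is 0 everywhere.\<close>
  have H: "infdist x ?H = 0 \<longleftrightarrow> x \<in> ?H" for x
    using in_closed_iff_infdist_zero[OF closed_zero_locus[of h, OF cont] ne] by simp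
  have "X - ?H \<noteq> {}"
    using x0 by (auto simp: opt_solutions_def)
  moreover have "continuous_on (X - ?H) (\<lambda>x. infdist x ?H)"
    by (intro continuous_intros)
  ultimately obtain k where k: "k \<in> X - ?H" "\<And>x. x \<in> X - ?H \<Longrightarrow> infdist k ?H \<le> infdist x ?H"
    using continuous_attains_inf[OF comp] by blast
  let ?\<delta> = "infdist k ?H"
  have "?\<delta> > 0"
    using k(1) H[of k] infdist_nonneg[of k ?H] by auto
  have "h_eps X h \<epsilon> = ereal (\<Sum>j\<in>UNIV. h j x0)" if \<epsilon>: "0 < \<epsilon>" "\<epsilon> < ?\<delta>" for \<epsilon>
  proof -
    \<comment> \<open>Points of the locus have distance 0 < \<open>\<epsilon>\<close>; all other
      points of \<open>X\<close> have distance at least that of the closest one, \<open>k\<close>,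
      which exceeds \<open>\<epsilon>\<close>.\<close>
    have "{x \<in> X. infdist x ?H \<ge> \<epsilon>} = X - ?H"
      using k(2) \<epsilon> H by force
    then show ?thesis
      using x0 by (simp add: h_eps_def opt_value_eq)
  qed
  then have "\<forall>\<^sub>F \<epsilon> in at_right 0. h_eps X h \<epsilon> = ereal (\<Sum>j\<in>UNIV. h j x0)"
    using \<open>?\<delta> > 0\<close>
    by (auto simp: eventually_at_right intro!: exI[of _ ?\<delta>])
  then have "(h_eps X h \<longlongrightarrow> ereal (\<Sum>j\<in>UNIV. h j x0)) (at_right 0)"
    by (rule tendsto_eventually)
  then show ?thesis
    unfolding h_tilde_def by (intro tendsto_Lim) auto
qed

theorem theorem1:
  fixes X :: "(real ^ 'n) set"
    and f :: "real ^ 'n \<Rightarrow> real"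
    and h :: "'m::finite \<Rightarrow> real ^ 'n \<Rightarrow> real"
  assumes "compact X"
    and "continuous_on X f"
    and "\<And>j. continuous_on UNIV (h j)"
    and "\<And>j x. x \<in> X \<Longrightarrow> h j x \<ge> 0"
    and "X \<inter> zero_locus h \<noteq> {}"
    and "closed (X - zero_locus h)"
  shows "(\<forall>y :: real ^ 'm. (\<forall>j. ereal (y $ j) \<ge> multiplier_bound X f h)
             \<longrightarrow> D_value X f h y = P_value X f h)
       \<and> (\<forall>y :: real ^ 'm. (\<forall>j. ereal (y $ j) > multiplier_bound X f h)
             \<longrightarrow> D_solutions X f h y = P_solutions X f h)"
proof -
  let ?H = "zero_locus h" and ?s = "\<lambda>x. \<Sum>j\<in>UNIV. h j x"
  have "compact (X \<inter> ?H)"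
    using assms(1) closed_zero_locus[of h, OF assms(3)] by (rule compact_Int_closed)
  then obtain p where p: "p \<in> opt_solutions (X \<inter> ?H) f"
    using opt_solutions_nonempty[of "X \<inter> ?H" f] assms(2,5)
    by (metis continuous_on_subset inf_le1 ex_in_conv)
  obtain d where d: "d \<in> opt_solutions X f"
    using opt_solutions_nonempty[of X f] assms(1,2,5) by blast
  have "f d \<le> f p"
    using p d by (auto simp: opt_solutions_def)
  have compK: "compact (X - ?H)"
    using compact_Int_closed[OF assms(1,6)] by (simp add: Int_absorb1 Diff_subset)
  \<comment> \<open>If \<open>X - ?H\<close> is empty, \<open>h_tilde\<close> is infinite and there
    are no infeasible points to estimate. Each later use supplies an infeasible \<open>x\<close>,
    which discharges the condition.\<close>
  have "\<exists>b. multiplier_bound X f h = ereal b \<and> 0 \<le> b \<and> (\<forall>x \<in> X - ?H. f p \<le> f x + b * ?s x)"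
    if ne: "X - ?H \<noteq> {}"
  proof -
    have "continuous_on (X - ?H) ?s"
      by (intro continuous_on_sum continuous_on_subset[OF assms(3)]) auto
    then obtain x0 where x0: "x0 \<in> opt_solutions (X - ?H) ?s"
      using opt_solutions_nonempty[OF compK ne] by blast
    have "?s x0 > 0"
    proof -
      obtain i where "x0 \<in> X" "h i x0 \<noteq> 0"
        using x0 by (auto simp: opt_solutions_def zero_locus_def)
      then show ?thesis
        using assms(4)[of x0] by (intro sum_pos2[where i = i]) (auto simp: order_less_le)
    qed
    define b where "b = (f p - f d) / ?s x0"
    have "h_tilde X h = ereal (?s x0)"
      using assms(5) by (intro h_tilde_eq_minimum[OF assms(3) compK _ x0]) auto
    then have "multiplier_bound X f h = ereal b"
      using \<open>?s x0 > 0\<close> opt_value_eq[OF p] opt_value_eq[OF d]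
      by (simp add: multiplier_bound_def P_value_def D_value_def b_def)
    moreover have "0 \<le> b"
      using \<open>f d \<le> f p\<close> \<open>?s x0 > 0\<close> by (simp add: b_def)
    moreover have "f p \<le> f x + b * ?s x" if x: "x \<in> X - ?H" for x
    proof -
      have "f d \<le> f x" "?s x0 \<le> ?s x"
        using d x0 x by (auto simp: opt_solutions_def)
      \<comment> \<open>\<open>b\<close> is the slope that closes the gap between \<open>f d\<close>
        and \<open>f p\<close> exactly where \<open>?s\<close> is smallest on
        \<open>X - ?H\<close>.\<close>
      moreover have "f p = f d + b * ?s x0"
        using \<open>?s x0 > 0\<close> by (simp add: b_def)
      ultimately show ?thesis
        using mult_left_mono[of "?s x0" "?s x" b] \<open>0 \<le> b\<close> by linarith
    qed
    ultimately show ?thesis by blast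
  qed
  note bound = this
  have "f p \<le> lagrangian f h y x"
    if y: "\<forall>j. ereal (y $ j) \<ge> multiplier_bound X f h" and x: "x \<in> X - ?H" for x y
  proof -
    obtain b where b: "multiplier_bound X f h = ereal b" "f p \<le> f x + b * ?s x"
      using bound x by blast
    have "b * ?s x \<le> (\<Sum>j\<in>UNIV. y $ j * h j x)"
      unfolding sum_distrib_left using y b(1) x assms(4)
      by (intro sum_mono mult_right_mono) auto
    then show ?thesis
      using b(2) by (simp add: lagrangian_def)
  qed
  moreover have "f p < lagrangian f h y x"
    if y: "\<forall>j. ereal (y $ j) > multiplier_bound X f h" and x: "x \<in> X - ?H" for x y
  proof -
    obtain b where b: "multiplier_bound X f h = ereal b" "f p \<le> f x + b * ?s x"
      using bound x by blast
    \<comment> \<open>Terms with \<open>h j x = 0\<close> give equality however large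
      \<open>y $ j\<close> is, so strictness must come from a constraint violated at
      \<open>x\<close>; there \<open>h i x > 0\<close>.\<close>
    obtain i where "h i x \<noteq> 0"
      using x by (auto simp: zero_locus_def)
    then have "b * h i x < y $ i * h i x"
      using y b(1) x assms(4)[of x i] by auto
    moreover have "b * h j x \<le> y $ j * h j x" for j
      using y b(1) x assms(4)[of x j] by (intro mult_right_mono) (auto simp: less_imp_le)
    ultimately have "b * ?s x < (\<Sum>j\<in>UNIV. y $ j * h j x)"
      unfolding sum_distrib_left by (intro sum_strict_mono_ex1) auto
    then show ?thesis
      using b(2) by (simp add: lagrangian_def)
  qed
  ultimately show ?thesis
    using p lagrangian_eq_on_zero_locus[of _ h f]
    unfolding D_value_def P_value_def D_solutions_def P_solutions_def
    by (intro conjI allI impI opt_value_exact_extension[where p = p]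
        opt_solutions_exact_extension[where p = p]) auto
qed

end
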